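(* Let $F$ be a finite field of characteristic $p$ and order $q$, and let $d$ be a positive integer with $\gcd(d,q-1)=1$ such that $d$ is not degenerate over $F$. Then $V_{F,d}\le\frac23[F:\mathbb{F}_p]$.
   Context: $\psi$ is the canonical additive character of $F$, $\psi(x)=e^{2\pi i\operatorname{Tr}(x)/p}$ with $\operatorname{Tr}$ the absolute trace $F\to\mathbb{F}_p$. For $a\in F$, $W_{F,d}(a)=\sum_{x\in F}\psi(x^d-ax)$, and $V_{F,d}=\min_{a\in F}\operatorname{val}_p(W_{F,d}(a))$, where $\operatorname{val}_p$ is the $p$-adic valuation extended to $\mathbb{Q}(e^{2\pi i/p})$ with $\operatorname{val}_p(1-e^{2\pi i/p})=1/(p-1)$ (so $\operatorname{val}_p(p)=1$). The exponent $d$ is degenerate over $F$ if $d$ is congruent to a power of $p$ modulo $q-1$. *)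

theory Defs
  imports
    Complex_Main
    "HOL-Library.Cardinality"
    "HOL-Library.Extended_Real"
    "HOL-Number_Theory.Cong"
    "HOL-Algebra.Algebraic_Closure_Type"
begin

text \<open>
  The field \<open>F\<close> is a type of class \<open>finite_field\<close>: \<open>p = CHAR('a)\<close> and \<open>q = CARD('a)\<close>.
  The prime field \<open>\<F>\<^sub>p\<close> is the subfield \<open>range of_int\<close> of \<open>F\<close>.
\<close>

definition prime_degree :: "'a::finite_field itself \<Rightarrow> nat" where
  "prime_degree _ =
     ring.dim (ring_of_type_algebra :: 'a ring) (range of_int) (UNIV :: 'a set)"

definition abs_trace :: "'a::finite_field \<Rightarrow> 'a" where
  "abs_trace x = (\<Sum>i<prime_degree TYPE('a). x ^ (CHAR('a) ^ i))"

text \<open>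
  An element of \<open>\<F>\<^sub>p\<close> enters the exponential through its representative in \<open>{0..<p}\<close>.
\<close>

definition canonical_char :: "'a::finite_field \<Rightarrow> complex" where
  "canonical_char x =
     exp (2 * pi * \<i> * of_nat (LEAST k. of_nat k = abs_trace x) / of_nat CHAR('a))"

definition weil_sum :: "nat \<Rightarrow> 'a::finite_field \<Rightarrow> complex" where
  "weil_sum d a = (\<Sum>x\<in>UNIV. canonical_char (x ^ d - a * x))"

definition zeta :: "nat \<Rightarrow> complex" where
  "zeta p = exp (2 * pi * \<i> / of_nat p)"

definition cyclotomic_ints :: "nat \<Rightarrow> complex set" where
  "cyclotomic_ints p = range (\<lambda>f :: int poly. poly (map_poly of_int f) (zeta p))"

text \<open>
  The ring \<open>\<int>[\<zeta>]\<close>, with \<open>\<zeta> = zeta p\<close>, has exactly one prime above \<open>p\<close>, generated by \<open>1 - \<zeta>\<close>,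
  so the \<open>p\<close>-adic valuation has a unique extension to \<open>\<rat>(\<zeta>)\<close>: a nonzero
  \<open>z = (1 - \<zeta>)\<^sup>k u / v\<close> with \<open>u, v \<in> \<int>[\<zeta>]\<close> not divisible by \<open>1 - \<zeta>\<close> has valuation
  \<open>k / (p - 1)\<close>. The value is only meaningful for \<open>p\<close> prime and \<open>z \<in> \<rat>(\<zeta>)\<close>.
\<close>

definition val_p :: "nat \<Rightarrow> complex \<Rightarrow> ereal" where
  "val_p p z =
     (if z = 0 then \<infinity>
      else ereal (of_int (THE k :: int.
        \<exists>u v. {u, v} \<subseteq> cyclotomic_ints p - (\<lambda>w. (1 - zeta p) * w) ` cyclotomic_ints p \<and>
              z = (1 - zeta p) powi k * u / v) / (real p - 1)))"

definition weil_min_val :: "'a::finite_field itself \<Rightarrow> nat \<Rightarrow> ereal" where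
  "weil_min_val _ d = Min (range (\<lambda>a :: 'a. val_p CHAR('a) (weil_sum d a)))"

definition degenerate :: "'a::finite_field itself \<Rightarrow> nat \<Rightarrow> bool" where
  "degenerate _ d \<longleftrightarrow> (\<exists>k. [d = CHAR('a) ^ k] (mod (CARD('a) - 1)))"

end

theory Submission
  imports
    Defs
    "HOL-Analysis.Cartesian_Space"
    "HOL-Library.Real_Mod"
    "Jordan_Normal_Form.Char_Poly"
begin

text \<open>
  Write \<open>q = |F|\<close> and \<open>n = [F : \<F>\<^sub>p]\<close>. For a nonzero vector \<open>r\<close> of length \<open>k\<close>, orthogonality of
  characters and the homogeneity of \<open>\<Sum>\<^sub>i v\<^sub>i\<^sup>d\<close> give
  \<open>(q - 1) \<Sum>\<^sub>a \<Prod>\<^sub>i W(r\<^sub>i a) = q (q M - q\<^bsup>k - 1\<^esup>)\<close>, where \<open>M\<close> counts the zeros of \<open>\<Sum>\<^sub>i v\<^sub>i\<^sup>d\<close> on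
  the hyperplane \<open>\<Sum>\<^sub>i r\<^sub>i v\<^sub>i = 0\<close>. Let \<open>k = 3\<close>. If every \<open>W(a)\<close> had valuation above \<open>2n/3\<close>, the
  left side would have valuation above \<open>2n\<close>, whereas for \<open>M = 1\<close> the right side \<open>q\<^sup>2 (1 - q)\<close> has
  valuation \<open>2n\<close>. So \<open>M \<noteq> 1\<close>: every line of the projective plane meets the curve
  \<open>x\<^sup>d + y\<^sup>d + z\<^sup>d = 0\<close>. As \<open>x \<mapsto> x\<^sup>d\<close> is bijective, the curve is the graph of a function \<open>g\<close> in the
  chart \<open>z = -1\<close>, and its only point at infinity is \<open>(1 : -1 : 0)\<close>. Hence \<open>x \<mapsto> g x - s x\<close> is onto,
  and therefore injective, for every \<open>s \<noteq> -1\<close>, which says that all chords of the graph have slope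
  \<open>-1\<close>. So \<open>g x = 1 - x\<close>, which makes \<open>x \<mapsto> x\<^sup>d\<close> additive and \<open>d\<close> degenerate.
\<close>

hide_const (open) Divisibility.prime Polynomials.degree

section \<open>Power maps on finite fields\<close>

lemma power_eq_if_cong:
  fixes x :: "'a::monoid_mult"
  assumes "x ^ n = 1" "[j = k] (mod n)"
  shows "x ^ j = x ^ k"
proof -
  have "x ^ m = x ^ (m mod n)" for m
  proof -
    have "x ^ m = x ^ (n * (m div n) + m mod n)"
      by simp
    also have "\<dots> = x ^ (m mod n)"
      by (simp only: power_add power_mult assms(1) power_one mult_1)
    finally show ?thesis .
  qed
  thus ?thesis
    using assms(2) unfolding cong_def by metis
qed

lemma one_less_CARD_finite_field: "1 < CARD('a::finite_field)"
proof -
  have "card {0, 1 :: 'a} \<le> CARD('a)"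
    by (intro card_mono) auto
  thus ?thesis
    by simp
qed

lemma finite_field_power_card_minus_1:
  fixes x :: "'a::finite_field"
  assumes "x \<noteq> 0"
  shows "x ^ (CARD('a) - 1) = 1"
proof -
  have "x ^ (CARD('a) - 1) * x = x ^ CARD('a)"
    by (rule power_minus_mult) (rule finite_UNIV_card_ge_0[OF finite])
  also have "\<dots> = x"
    by (rule finite_field_power_card_eq_same)
  finally show ?thesis
    using assms by simp
qed

lemma bij_power_coprime:
  assumes "d > 0" "coprime d (CARD('a::finite_field) - 1)"
  shows "bij (\<lambda>x::'a. x ^ d)"
proof -
  obtain e where e_inverse: "[d * e = 1] (mod (CARD('a) - 1))"
    using cong_solve_coprime_nat[OF assms(2)] by auto
  have power_e: "(x ^ d) ^ e = x" if "x \<noteq> 0" for x :: 'a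
    using power_eq_if_cong[OF finite_field_power_card_minus_1[OF that] e_inverse]
    by (simp add: power_mult)
  have "inj (\<lambda>x::'a. x ^ d)"
  proof (rule injI)
    fix x y :: 'a
    assume eq: "x ^ d = y ^ d"
    show "x = y"
    proof (cases "x = 0 \<or> y = 0")
      case True
      thus ?thesis
        using eq assms(1) by (auto simp: power_0_left)
    next
      case False
      thus ?thesis
        using power_e[of x] power_e[of y] eq by metis
    qed
  qed
  thus ?thesis
    by (simp add: bij_def finite_UNIV_inj_surj)
qed

lemma power_minus_of_inj:
  fixes x :: "'a::idom"
  assumes "inj (\<lambda>x::'a. x ^ d)"
  shows "(- x) ^ d = - (x ^ d)"
proof -
  have "((-1 :: 'a) ^ d)\<^sup>2 = 1"
    by (simp flip: power_mult add: mult.commute)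
  hence "(-1 :: 'a) ^ d = 1 \<or> (-1 :: 'a) ^ d = -1"
    by (simp add: power2_eq_1_iff)
  hence "(-1 :: 'a) ^ d = -1"
    using injD[OF assms, of "-1" 1] by auto
  thus ?thesis
    by (subst power_minus) simp
qed

lemma power_add_power_eq_0_iff:
  fixes x y :: "'a::idom"
  assumes "inj (\<lambda>x::'a. x ^ d)"
  shows "x ^ d + y ^ d = 0 \<longleftrightarrow> y = - x"
proof -
  have "x ^ d + y ^ d = 0 \<longleftrightarrow> y ^ d = (- x) ^ d"
    by (auto simp: power_minus_of_inj[OF assms] eq_neg_iff_add_eq_0 add.commute)
  also have "\<dots> \<longleftrightarrow> y = - x"
    using inj_eq[OF assms] by simp
  finally show ?thesis .
qed

lemma power_CHAR_eq_iff:
  fixes x y :: "'a::idom"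
  assumes "prime CHAR('a)"
  shows "x ^ CHAR('a) = y ^ CHAR('a) \<longleftrightarrow> x = y"
proof
  assume "x ^ CHAR('a) = y ^ CHAR('a)"
  moreover have "(x - y + y) ^ CHAR('a) = (x - y) ^ CHAR('a) + y ^ CHAR('a)"
    by (rule freshmans_dream) (simp_all add: assms)
  ultimately show "x = y"
    by simp
qed simp

lemma one_plus_X_power_imp_CHAR_power:
  assumes "prime CHAR('a::idom)" "e > 0" "[:1, 1 :: 'a:] ^ e = 1 + monom 1 e"
  obtains k where "e = CHAR('a) ^ k"
  using assms(2,3)
proof (induction e arbitrary: thesis rule: less_induct)
  case (less e)
  let ?p = "CHAR('a)"
  show ?case
  proof (cases "?p dvd e")
    case False
    have "of_nat e = coeff ([:1, 1 :: 'a:] ^ e) 1"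
      using less.prems(2) by (simp add: coeff_linear_poly_power)
    also have "\<dots> = (if e = 1 then 1 else 0)"
      using less.prems(3) by simp
    finally have "e = 1"
      using False by (simp add: of_nat_eq_0_iff_char_dvd split: if_splits)
    thus ?thesis
      using less.prems(1)[of 0] by simp
  next
    case True
    then obtain m where e_eq: "e = m * ?p"
      by (metis dvdE mult.commute)
    have m_bounds: "m > 0" "m < e"
      using less.prems(2) prime_gt_1_nat[OF assms(1)] by (auto simp: e_eq)
    have "(1 + monom 1 m) ^ ?p = 1 ^ ?p + (monom 1 m :: 'a poly) ^ ?p"
      by (rule freshmans_dream) (simp_all add: assms(1))
    also have "\<dots> = ([:1, 1:] ^ m) ^ ?p"
      using less.prems(3) by (simp add: e_eq monom_power power_mult)
    finally have "[:1, 1 :: 'a:] ^ m = 1 + monom 1 m"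
      using power_CHAR_eq_iff[where ?'a = "'a poly"] assms(1) by (metis semiring_char_poly)
    then obtain k where "m = ?p ^ k"
      using less.IH[OF m_bounds(2) _ m_bounds(1)] by auto
    thus ?thesis
      using less.prems(1)[of "Suc k"] by (simp add: e_eq)
  qed
qed

lemma additive_power_imp_degenerate:
  assumes "d > 0" and add: "\<And>x :: 'a::finite_field. (1 + x) ^ d = 1 + x ^ d"
  shows "degenerate TYPE('a) d"
proof -
  define e where "e = (d - 1) mod (CARD('a) - 1) + 1"
  have "(d - 1) mod (CARD('a) - 1) < CARD('a) - 1"
    using one_less_CARD_finite_field[where ?'a = 'a] by (intro mod_less_divisor) simp
  hence e_bounds: "0 < e" "e < CARD('a)"
    unfolding e_def by linarith+
  have "[d - 1 + 1 = e] (mod (CARD('a) - 1))"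
    unfolding e_def cong_add_rcancel_nat by (simp add: cong_def)
  hence cong: "[d = e] (mod (CARD('a) - 1))"
    using assms(1) by simp
  have power_e: "x ^ d = x ^ e" for x :: 'a
    using power_eq_if_cong[OF finite_field_power_card_minus_1 cong, of x] assms(1) e_bounds(1)
    by (cases "x = 0") (simp_all add: power_0_left)
  define f where "f = [:1, 1 :: 'a:] ^ e - (1 + monom 1 e)"
  have "{x. poly f x = 0} = UNIV"
    using add by (auto simp: f_def poly_monom poly_power power_e)
  moreover have "degree f \<le> e"
    unfolding f_def
    by (intro degree_diff_le degree_add_le) (auto simp: degree_power_eq degree_monom_eq)
  ultimately have "f = 0"
    using card_poly_roots_bound[of f] e_bounds(2) by fastforce
  then obtain k where "e = CHAR('a) ^ k"
    using one_plus_X_power_imp_CHAR_power[where ?'a = 'a, of e] e_bounds(1) by (auto simp: f_def)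
  thus ?thesis
    using cong by (auto simp: degenerate_def)
qed

section \<open>Blocking sets and Fermat hypersurfaces\<close>

lemma affine_if_inj_minus_linear:
  fixes g :: "'a::field \<Rightarrow> 'a"
  assumes "\<And>s. s \<noteq> c \<Longrightarrow> inj (\<lambda>x. g x - s * x)"
  shows "g x = g 0 + c * x"
proof (cases "x = 0")
  case False
  define s where "s = (g x - g 0) / x"
  have "g x - s * x = g 0 - s * 0"
    using False by (simp add: s_def)
  hence "s = c"
    using injD[OF assms[of s], of x 0] False by auto
  thus ?thesis
    using False by (simp add: s_def field_simps)
qed simp

definition hyperplane :: "('n::finite \<Rightarrow> 'a::comm_semiring_1) \<Rightarrow> ('n \<Rightarrow> 'a) set" where
  "hyperplane r = {v. (\<Sum>i\<in>UNIV. r i * v i) = 0}"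

definition fermat_cone :: "nat \<Rightarrow> ('n::finite \<Rightarrow> 'a::comm_semiring_1) set" where
  "fermat_cone d = {v. (\<Sum>i\<in>UNIV. v i ^ d) = 0}"

definition blocking_cone :: "('n::finite \<Rightarrow> 'a::comm_semiring_1) set \<Rightarrow> bool" where
  "blocking_cone C \<longleftrightarrow> (\<forall>r. r \<noteq> (\<lambda>_. 0) \<longrightarrow> (\<exists>v \<in> hyperplane r \<inter> C. v \<noteq> (\<lambda>_. 0)))"

lemma blocking_fermat_cone_affine_point:
  fixes s c :: "'a::field"
  assumes inj: "inj (\<lambda>x::'a. x ^ d)" and d_pos: "d > 0" and slope: "s \<noteq> -1"
    and blocking: "blocking_cone (fermat_cone d :: (3 \<Rightarrow> 'a) set)"
  obtains x y where "x ^ d + y ^ d = 1" "y - s * x = c"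
proof -
  define r :: "3 \<Rightarrow> 'a" where "r = (\<lambda>i. if i = 1 then -s else if i = 2 then 1 else c)"
  have "r 2 \<noteq> 0"
    by (simp add: r_def)
  hence "r \<noteq> (\<lambda>_. 0)"
    by auto
  then obtain v where point: "v \<in> hyperplane r" "v \<in> fermat_cone d" "v \<noteq> (\<lambda>_. 0)"
    using blocking unfolding blocking_cone_def by blast
  have line: "v 2 - s * v 1 + c * v 3 = 0" and curve: "v 1 ^ d + v 2 ^ d + v 3 ^ d = 0"
    using point(1,2) by (simp_all add: hyperplane_def fermat_cone_def sum_3 r_def)
  have v3_nonzero: "v 3 \<noteq> 0"
  proof
    assume v3_zero: "v 3 = 0"
    hence "v 1 ^ d + v 2 ^ d = 0"
      using curve d_pos by (simp add: power_0_left)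
    hence neg_v: "v 2 = - v 1"
      by (simp only: power_add_power_eq_0_iff[OF inj])
    have "(s + 1) * v 1 = - (v 2 - s * v 1 + c * v 3)"
      by (simp add: neg_v v3_zero algebra_simps)
    hence "v 1 = 0"
      using slope line by (simp add: eq_neg_iff_add_eq_0)
    hence "\<forall>i. v i = 0"
      using neg_v v3_zero by (simp add: forall_3)
    thus False
      using point(3) by auto
  qed
  show ?thesis
  proof (rule that)
    have "(- (v 1 / v 3)) ^ d + (- (v 2 / v 3)) ^ d = - ((v 1 ^ d + v 2 ^ d) / v 3 ^ d)"
      by (simp add: power_minus_of_inj[OF inj] power_divide add_divide_distrib)
    also have "v 1 ^ d + v 2 ^ d = - (v 3 ^ d)"
      using curve by (simp add: eq_neg_iff_add_eq_0)
    finally show "(- (v 1 / v 3)) ^ d + (- (v 2 / v 3)) ^ d = 1"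
      using v3_nonzero by simp
    have "v 2 - s * v 1 = - c * v 3"
      using line by (simp add: eq_neg_iff_add_eq_0)
    thus "- (v 2 / v 3) - s * - (v 1 / v 3) = c"
      using v3_nonzero by (simp add: field_simps)
  qed
qed

lemma blocking_fermat_cone_imp_power_one_minus:
  fixes x :: "'a::finite_field"
  assumes bij: "bij (\<lambda>x::'a. x ^ d)" and d_pos: "d > 0"
    and blocking: "blocking_cone (fermat_cone d :: (3 \<Rightarrow> 'a) set)"
  shows "x ^ d + (1 - x) ^ d = 1"
proof -
  have "\<exists>y. y ^ d = 1 - x ^ d" for x :: 'a
    using surjD[OF bij_is_surj[OF bij], of "1 - x ^ d"] by auto
  then obtain g :: "'a \<Rightarrow> 'a" where g_power: "\<And>x. g x ^ d = 1 - x ^ d"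
    by metis
  have graph: "y = g x" if "x ^ d + y ^ d = 1" for x y
    by (rule injD[OF bij_is_inj[OF bij]]) (use that in \<open>simp add: g_power eq_diff_eq add.commute\<close>)
  have "inj (\<lambda>x. g x - s * x)" if slope: "s \<noteq> -1" for s
  proof (rule finite_UNIV_surj_inj)
    show "surj (\<lambda>x. g x - s * x)"
      unfolding surj_def
    proof
      fix c
      obtain x y where "x ^ d + y ^ d = 1" "y - s * x = c"
        using blocking_fermat_cone_affine_point[OF bij_is_inj[OF bij] d_pos slope blocking] by metis
      thus "\<exists>x. c = g x - s * x"
        using graph by blast
    qed
  qed simp
  hence "g x = g 0 + (-1) * x"
    by (rule affine_if_inj_minus_linear)
  also have "g 0 = 1"
    using d_pos by (intro graph[symmetric]) (simp add: power_0_left)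
  finally show ?thesis
    using g_power[of x] by simp
qed

section \<open>Algebraic integers\<close>

lemma algebraic_int_if_int_eigenvalue:
  fixes z :: "'a::field_char_0" and v :: "nat \<Rightarrow> 'a" and A :: "nat \<Rightarrow> nat \<Rightarrow> int"
  assumes eigen: "\<And>i. i < n \<Longrightarrow> z * v i = (\<Sum>j<n. of_int (A i j) * v j)"
    and nonzero: "k < n" "v k \<noteq> 0"
  shows "algebraic_int z"
proof -
  define M where "M = mat n n (\<lambda>(i, j). A i j)"
  have M_carrier: "M \<in> carrier_mat n n"
    by (simp add: M_def)
  have "eigenvector (of_int_hom.mat_hom M) (vec n v) z"
    unfolding eigenvector_def
  proof (intro conjI)
    show "vec n v \<noteq> 0\<^sub>v (dim_row (of_int_hom.mat_hom M))"
      using nonzero by (auto simp: M_def vec_eq_iff)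
    show "of_int_hom.mat_hom M *\<^sub>v vec n v = z \<cdot>\<^sub>v vec n v"
      by (rule eq_vecI) (simp_all add: M_def scalar_prod_def eigen atLeast0LessThan)
  qed (simp add: M_def)
  hence "poly (char_poly (of_int_hom.mat_hom M)) z = 0"
    using eigenvalue_root_char_poly[of "of_int_hom.mat_hom M" n z] M_carrier
    by (auto simp: eigenvalue_def)
  hence "poly (of_int_poly (char_poly M)) z = 0"
    by (simp add: of_int_hom.char_poly_hom[OF M_carrier])
  moreover have "lead_coeff (char_poly M) = 1"
    using degree_monic_char_poly[OF M_carrier] by simp
  ultimately show ?thesis
    by (auto simp: algebraic_int_altdef_ipoly)
qed

text \<open>
  The powers \<open>1, z, \<dots>, z\<^bsup>n - 1\<^esup>\<close> form an eigenvector of an integer matrix, with eigenvalue \<open>f(z)\<close>.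
\<close>

lemma algebraic_int_poly_root_of_unity:
  fixes z :: "'a::field_char_0"
  assumes "n > 0" "z ^ n = 1"
  shows "algebraic_int (poly (of_int_poly f) z)"
proof (rule algebraic_int_if_int_eigenvalue)
  fix i assume "i < n"
  have "poly (of_int_poly f) z * z ^ i = (\<Sum>k\<le>degree f. of_int (coeff f k) * z ^ ((k + i) mod n))"
    using power_eq_if_cong[OF assms(2), of "_ + i" "(_ + i) mod n"]
    by (simp add: poly_altdef sum_distrib_right mult.assoc cong_def flip: power_add)
  also have "\<dots> = (\<Sum>k\<le>degree f. \<Sum>j<n. if (k + i) mod n = j then of_int (coeff f k) * z ^ j else 0)"
    using assms(1) by simp
  also have "\<dots> = (\<Sum>j<n. of_int (\<Sum>k | k \<le> degree f \<and> (k + i) mod n = j. coeff f k) * z ^ j)"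
    by (subst sum.swap) (simp add: sum.If_cases sum_distrib_right Collect_conj_eq atMost_def)
  finally show "poly (of_int_poly f) z * z ^ i =
    (\<Sum>j<n. of_int (\<Sum>k | k \<le> degree f \<and> (k + i) mod n = j. coeff f k) * z ^ j)" .
qed (use assms in auto)

lemma nonzero_int_multiple_if_int_poly_root:
  fixes z :: "'a::field_char_0"
  assumes "poly (of_int_poly f) z = 0" "f \<noteq> 0" "z \<noteq> 0"
  obtains N g where "N \<noteq> 0" "of_int N = z * poly (of_int_poly g) z"
  using assms(1,2)
proof (induction f arbitrary: thesis)
  case (pCons a f)
  show ?case
  proof (cases "a = 0")
    case True
    thus ?thesis
      using pCons.IH[OF pCons.prems(1)] pCons.prems(2) pCons.hyps assms(3)
      by (simp add: of_int_hom.map_poly_pCons_hom)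
  next
    case False
    have "of_int (- a) = z * poly (of_int_poly f) z"
      using pCons.prems(2) by (simp add: of_int_hom.map_poly_pCons_hom add_eq_0_iff)
    thus ?thesis
      using pCons.prems(1)[of "- a" f] False by simp
  qed
qed simp

section \<open>The prime above \<open>p\<close> in the cyclotomic integers\<close>

lemma zeta_eq_cis: "zeta p = cis (2 * pi / real p)"
  by (simp add: zeta_def cis_conv_exp mult_ac)

lemma zeta_power_self:
  assumes "p > 0"
  shows "zeta p ^ p = 1"
  using assms by (simp add: zeta_eq_cis DeMoivre)

lemma zeta_neq_1:
  assumes "p > 1"
  shows "zeta p \<noteq> 1"
proof
  assume "zeta p = 1"
  then obtain n where "2 * pi / real p = of_int n * (2 * pi)"
    unfolding zeta_eq_cis cis_eq_1_iff by blast
  hence "real_of_int (int p * n) = real_of_int 1"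
    using assms by (simp add: field_simps)
  hence "int p * n = 1"
    by (simp only: of_int_eq_iff)
  thus False
    using assms by (simp add: zmult_eq_1_iff)
qed

lemma sum_zeta_powers:
  assumes "p > 1"
  shows "(\<Sum>i<p. zeta p ^ i) = 0"
  using one_diff_power_eq[of "zeta p" p] zeta_power_self[of p] zeta_neq_1[OF assms] assms by simp

abbreviation poly_zeta :: "nat \<Rightarrow> int poly \<Rightarrow> complex" where
  "poly_zeta p f \<equiv> poly (of_int_poly f) (zeta p)"

lemma cyclotomic_ints_iff: "z \<in> cyclotomic_ints p \<longleftrightarrow> (\<exists>f. z = poly_zeta p f)"
  by (auto simp: cyclotomic_ints_def)

lemma cyclotomic_ints_poly_zeta [simp]: "poly_zeta p f \<in> cyclotomic_ints p"
  by (auto simp: cyclotomic_ints_iff)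

lemma cyclotomic_ints_add [simp]:
  "x \<in> cyclotomic_ints p \<Longrightarrow> y \<in> cyclotomic_ints p \<Longrightarrow> x + y \<in> cyclotomic_ints p"
  unfolding cyclotomic_ints_iff by (metis of_int_poly_hom.hom_add poly_add)

lemma cyclotomic_ints_diff [simp]:
  "x \<in> cyclotomic_ints p \<Longrightarrow> y \<in> cyclotomic_ints p \<Longrightarrow> x - y \<in> cyclotomic_ints p"
  unfolding cyclotomic_ints_iff by (metis of_int_poly_hom.hom_minus poly_diff)

lemma cyclotomic_ints_mult [simp]:
  "x \<in> cyclotomic_ints p \<Longrightarrow> y \<in> cyclotomic_ints p \<Longrightarrow> x * y \<in> cyclotomic_ints p"
  unfolding cyclotomic_ints_iff by (metis of_int_poly_hom.hom_mult poly_mult)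

lemma cyclotomic_ints_of_int [simp]: "of_int k \<in> cyclotomic_ints p"
  using cyclotomic_ints_poly_zeta[of "[:k:]" p] by (simp add: of_int_hom.map_poly_pCons_hom)

lemma cyclotomic_ints_of_nat [simp]: "of_nat k \<in> cyclotomic_ints p"
  using cyclotomic_ints_of_int[of "int k" p] by simp

lemma cyclotomic_ints_0 [simp]: "0 \<in> cyclotomic_ints p"
  using cyclotomic_ints_of_int[of 0 p] by simp

lemma cyclotomic_ints_1 [simp]: "1 \<in> cyclotomic_ints p"
  using cyclotomic_ints_of_int[of 1 p] by simp

lemma cyclotomic_ints_zeta [simp]: "zeta p \<in> cyclotomic_ints p"
  using cyclotomic_ints_poly_zeta[of "[:0, 1:]" p] by (simp add: of_int_hom.map_poly_pCons_hom)

lemma cyclotomic_ints_power [simp]: "x \<in> cyclotomic_ints p \<Longrightarrow> x ^ n \<in> cyclotomic_ints p"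
  by (induction n) simp_all

lemma cyclotomic_ints_sum [simp]:
  "(\<And>i. i \<in> A \<Longrightarrow> f i \<in> cyclotomic_ints p) \<Longrightarrow> (\<Sum>i\<in>A. f i) \<in> cyclotomic_ints p"
  by (induction A rule: infinite_finite_induct) simp_all

lemma cyclotomic_ints_prod [simp]:
  "(\<And>i. i \<in> A \<Longrightarrow> f i \<in> cyclotomic_ints p) \<Longrightarrow> (\<Prod>i\<in>A. f i) \<in> cyclotomic_ints p"
  by (induction A rule: infinite_finite_induct) simp_all

lemma algebraic_int_cyclotomic_ints:
  assumes "p > 0" "z \<in> cyclotomic_ints p"
  shows "algebraic_int z"
  using assms algebraic_int_poly_root_of_unity[OF assms(1) zeta_power_self]
  by (auto simp: cyclotomic_ints_iff)

lemma inverse_of_nat_notin_cyclotomic_ints: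
  assumes "p > 0" "n > 1"
  shows "inverse (of_nat n) \<notin> cyclotomic_ints p"
proof
  assume "inverse (of_nat n) \<in> cyclotomic_ints p"
  hence "inverse (of_nat n :: complex) \<in> \<int>"
    using algebraic_int_cyclotomic_ints[OF assms(1)] by (intro rational_algebraic_int_is_int) auto
  then obtain m where "inverse (of_nat n :: complex) = of_int m"
    by (elim Ints_cases)
  hence "(of_int (int n * m) :: complex) = of_int 1"
    using assms(2) by (simp add: field_simps)
  hence "int n * m = 1"
    by (simp only: of_int_eq_iff)
  thus False
    using assms(2) by (simp add: zmult_eq_1_iff)
qed

lemma cyclotomic_int_dvd_int:
  assumes "p > 0" "z \<in> cyclotomic_ints p" "z \<noteq> 0"
  obtains N w where "N \<noteq> 0" "w \<in> cyclotomic_ints p" "of_int N = z * w"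
proof -
  obtain f where "poly (of_int_poly f) z = 0" "lead_coeff f = 1"
    using algebraic_int_cyclotomic_ints[OF assms(1,2)] by (auto simp: algebraic_int_altdef_ipoly)
  moreover from this have "f \<noteq> 0"
    by auto
  ultimately obtain N g where "N \<noteq> 0" "of_int N = z * poly (of_int_poly g) z"
    using nonzero_int_multiple_if_int_poly_root assms(3) by metis
  moreover have "poly (of_int_poly g) z \<in> cyclotomic_ints p"
    using assms(2) by (simp add: poly_altdef)
  ultimately show ?thesis
    using that by blast
qed

abbreviation lambda :: "nat \<Rightarrow> complex" where
  "lambda p \<equiv> 1 - zeta p"

abbreviation lambda_ideal :: "nat \<Rightarrow> complex set" where
  "lambda_ideal p \<equiv> (\<lambda>w. lambda p * w) ` cyclotomic_ints p"

lemma lambda_ideal_add: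
  assumes "x \<in> lambda_ideal p" "y \<in> lambda_ideal p"
  shows "x + y \<in> lambda_ideal p"
  using assms by (auto simp flip: distrib_left)

lemma lambda_ideal_diff:
  assumes "x \<in> lambda_ideal p" "y \<in> lambda_ideal p"
  shows "x - y \<in> lambda_ideal p"
  using assms by (auto simp flip: right_diff_distrib)

lemma lambda_ideal_mult:
  assumes "x \<in> cyclotomic_ints p" "y \<in> lambda_ideal p"
  shows "x * y \<in> lambda_ideal p"
  using assms by (auto simp: mult.left_commute[of x])

lemma poly_zeta_eq_synthetic_div:
  "poly_zeta p f = of_int (poly f 1) - lambda p * poly_zeta p (synthetic_div f 1)"
proof -
  have "poly_zeta p f = poly_zeta p ([:-1, 1:] * synthetic_div f 1 + [:poly f 1:])"
    by (simp only: synthetic_div_correct')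
  thus ?thesis
    unfolding of_int_poly_hom.hom_add of_int_poly_hom.hom_mult
    by (simp add: of_int_hom.map_poly_pCons_hom algebra_simps)
qed

lemma of_nat_prime_in_lambda_ideal:
  assumes "p > 1"
  shows "of_nat p \<in> lambda_ideal p"
proof -
  define f :: "int poly" where "f = (\<Sum>i<p. monom 1 i)"
  have "poly_zeta p f = 0"
    using sum_zeta_powers[OF assms] by (simp add: f_def of_int_poly_hom.hom_sum poly_sum poly_monom)
  moreover have "poly f 1 = int p"
    by (simp add: f_def poly_sum poly_monom)
  ultimately show ?thesis
    using poly_zeta_eq_synthetic_div[of f p] by auto
qed

lemma prime_dvd_signed_binomial_minus_1:
  assumes "prime p" "i < p"
  shows "int p dvd (-1) ^ i * int ((p - 1) choose i) - 1"
  using assms(2)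
proof (induction i)
  case (Suc i)
  have "p choose Suc i = ((p - 1) choose i) + ((p - 1) choose Suc i)"
    using Suc.prems by (cases p) simp_all
  hence "(-1) ^ Suc i * int ((p - 1) choose Suc i) - 1 =
      ((-1) ^ i * int ((p - 1) choose i) - 1) + (-1) ^ Suc i * int (p choose Suc i)"
    by (simp add: algebra_simps)
  moreover have "int p dvd int (p choose Suc i)"
    using dvd_choose_prime[of "Suc i" p] Suc.prems assms(1) by simp
  ultimately show ?case
    using Suc by (metis Suc_lessD dvd_add dvd_mult)
qed simp

lemma prime_dvd_one_minus_X_power_diff:
  assumes "prime p"
  shows "[:int p:] dvd [:1, -1:] ^ (p - 1) - (\<Sum>i<p. monom 1 i)"
  unfolding const_poly_dvd_iff
proof
  fix i
  show "int p dvd coeff ([:1, -1:] ^ (p - 1) - (\<Sum>i<p. monom 1 i)) i"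
  proof (cases "i < p")
    case True
    thus ?thesis
      using prime_dvd_signed_binomial_minus_1[OF assms, of i]
      by (simp add: coeff_linear_poly_power coeff_sum mult.commute)
  next
    case False
    have "degree ([:1, -1 :: int:] ^ (p - 1)) \<le> p - 1"
      using degree_power_le[of "[:1, -1 :: int:]" "p - 1"] by simp
    also have "\<dots> < i"
      using False prime_gt_0_nat[OF assms] by simp
    finally show ?thesis
      using False by (simp add: coeff_eq_0 coeff_sum)
  qed
qed

lemma lambda_power_eq_prime_mult:
  assumes "prime p"
  obtains f where "poly f 1 = -1" "lambda p ^ (p - 1) = of_nat p * poly_zeta p f"
proof -
  obtain f where expansion: "[:1, -1:] ^ (p - 1) = (\<Sum>i<p. monom 1 i) + smult (int p) f"
    using prime_dvd_one_minus_X_power_diff[OF assms] by (auto simp: dvd_def diff_eq_eq add.commute)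
  have p_gt_1: "p > 1"
    using assms by (rule prime_gt_1_nat)
  have "poly ([:1, -1:] ^ (p - 1)) 1 = int p + int p * poly f 1"
    unfolding expansion by (simp add: poly_sum poly_monom)
  hence "int p * (1 + poly f 1) = 0"
    using p_gt_1 by (simp add: poly_power power_0_left distrib_left)
  hence "poly f 1 = -1"
    using p_gt_1 by simp
  moreover have "lambda p ^ (p - 1) = poly_zeta p ([:1, -1:] ^ (p - 1))"
    by (simp add: of_int_poly_hom.hom_power of_int_hom.map_poly_pCons_hom poly_power)
  hence "lambda p ^ (p - 1) = of_nat p * poly_zeta p f"
    unfolding expansion using sum_zeta_powers[OF p_gt_1]
    by (simp add: of_int_poly_hom.hom_add of_int_poly_hom.hom_sum of_int_hom.map_poly_hom_smult
        poly_sum poly_monom)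
  ultimately show ?thesis
    by (rule that)
qed

lemma one_notin_lambda_ideal:
  assumes "prime p"
  shows "1 \<notin> lambda_ideal p"
proof
  assume "1 \<in> lambda_ideal p"
  then obtain w where inverse: "w \<in> cyclotomic_ints p" "1 = lambda p * w"
    by auto
  obtain f where "lambda p ^ (p - 1) = of_nat p * poly_zeta p f"
    using lambda_power_eq_prime_mult[OF assms] by blast
  hence "1 = of_nat p * (poly_zeta p f * w ^ (p - 1))"
    using inverse(2) by (metis mult.assoc power_mult_distrib power_one)
  hence "inverse (of_nat p) = poly_zeta p f * w ^ (p - 1)"
    by (metis inverse_unique)
  moreover have "\<dots> \<in> cyclotomic_ints p"
    using inverse(1) by simp
  ultimately show False
    using inverse_of_nat_notin_cyclotomic_ints[of p p] prime_gt_1_nat[OF assms] by simp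
qed

lemma of_int_in_lambda_ideal_iff:
  assumes "prime p"
  shows "of_int m \<in> lambda_ideal p \<longleftrightarrow> int p dvd m"
proof
  assume mem: "of_int m \<in> lambda_ideal p"
  show "int p dvd m"
  proof (rule ccontr)
    assume "\<not> int p dvd m"
    hence "coprime (int p) m"
      using assms by (simp add: prime_imp_coprime)
    then obtain a b where "a * int p + b * m = 1"
      using bezout_int[of "int p" m] by (auto simp: coprime_iff_gcd_eq_1)
    hence "1 = of_int a * of_nat p + of_int b * (of_int m :: complex)"
      by (metis of_int_1 of_int_add of_int_mult of_int_of_nat_eq)
    also have "\<dots> \<in> lambda_ideal p"
      using of_nat_prime_in_lambda_ideal[OF prime_gt_1_nat[OF assms]] mem
      by (intro lambda_ideal_add lambda_ideal_mult) simp_all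
    finally show False
      using one_notin_lambda_ideal[OF assms] by simp
  qed
next
  assume "int p dvd m"
  then obtain k where "m = k * int p"
    by (metis dvdE mult.commute)
  thus "of_int m \<in> lambda_ideal p"
    using of_nat_prime_in_lambda_ideal[OF prime_gt_1_nat[OF assms]]
    by (simp add: lambda_ideal_mult)
qed

lemma poly_zeta_in_lambda_ideal_iff:
  assumes "prime p"
  shows "poly_zeta p f \<in> lambda_ideal p \<longleftrightarrow> int p dvd poly f 1"
proof -
  define w where "w = lambda p * poly_zeta p (synthetic_div f 1)"
  have w_mem: "w \<in> lambda_ideal p"
    unfolding w_def by (intro imageI cyclotomic_ints_poly_zeta)
  have eq: "poly_zeta p f = of_int (poly f 1) - w"
    unfolding w_def by (rule poly_zeta_eq_synthetic_div)
  have "of_int (poly f 1) - w \<in> lambda_ideal p \<longleftrightarrow> of_int (poly f 1) \<in> lambda_ideal p"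
    using lambda_ideal_add[OF _ w_mem, of "of_int (poly f 1) - w"] lambda_ideal_diff[OF _ w_mem]
    by auto
  thus ?thesis
    by (simp only: eq of_int_in_lambda_ideal_iff[OF assms])
qed

lemma lambda_ideal_mult_iff:
  assumes "prime p" "u \<in> cyclotomic_ints p" "v \<in> cyclotomic_ints p"
  shows "u * v \<in> lambda_ideal p \<longleftrightarrow> u \<in> lambda_ideal p \<or> v \<in> lambda_ideal p"
proof -
  obtain f g where poly_eqs: "u = poly_zeta p f" "v = poly_zeta p g"
    using assms by (auto simp: cyclotomic_ints_iff)
  hence "u * v = poly_zeta p (f * g)"
    by (simp add: of_int_poly_hom.hom_mult)
  thus ?thesis
    using assms(1) by (simp only: poly_eqs poly_zeta_in_lambda_ideal_iff)
      (simp add: prime_dvd_mult_iff)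
qed

section \<open>The extended \<open>p\<close>-adic valuation\<close>

text \<open>These elements are invertible only after localizing \<open>\<int>[\<zeta>]\<close> at \<open>1 - \<zeta>\<close>.\<close>

abbreviation lambda_units :: "nat \<Rightarrow> complex set" where
  "lambda_units p \<equiv> cyclotomic_ints p - lambda_ideal p"

lemma one_in_lambda_units:
  assumes "prime p"
  shows "1 \<in> lambda_units p"
  using one_notin_lambda_ideal[OF assms] by simp

lemma lambda_units_mult:
  assumes "prime p" "u \<in> lambda_units p" "v \<in> lambda_units p"
  shows "u * v \<in> lambda_units p"
  using assms by (simp add: lambda_ideal_mult_iff)

lemma lambda_units_nonzero:
  assumes "u \<in> lambda_units p"
  shows "u \<noteq> 0"
  using assms by (auto intro: image_eqI[of _ _ 0])

lemma lambda_nonzero: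
  assumes "prime p"
  shows "lambda p \<noteq> 0"
  using zeta_neq_1[OF prime_gt_1_nat[OF assms]] by simp

lemma lambda_power_dvd_imp_prime_dvd:
  assumes prime: "prime p" and w_cyclotomic: "w \<in> cyclotomic_ints p"
    and eq: "of_nat p ^ s * of_int m = lambda p ^ (s * (p - 1) + 1) * w"
  shows "int p dvd m"
proof -
  obtain f where lambda_power: "lambda p ^ (p - 1) = of_nat p * poly_zeta p f"
    using lambda_power_eq_prime_mult[OF prime] by blast
  have "lambda p ^ (s * (p - 1) + 1) = (lambda p ^ (p - 1)) ^ s * lambda p"
    by (simp add: power_add mult.commute flip: power_mult)
  also have "\<dots> = of_nat p ^ s * poly_zeta p f ^ s * lambda p"
    by (simp only: lambda_power power_mult_distrib)
  finally have "of_nat p ^ s * of_int m = of_nat p ^ s * (lambda p * (poly_zeta p f ^ s * w))"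
    using eq by (simp only: mult_ac)
  hence "of_int m = lambda p * (poly_zeta p f ^ s * w)"
    using prime_gt_0_nat[OF prime] by simp
  hence "of_int m \<in> lambda_ideal p"
    using w_cyclotomic by auto
  thus ?thesis
    using of_int_in_lambda_ideal_iff[OF prime] by simp
qed

lemma lambda_power_exponent_bounded:
  assumes prime: "prime p" and z_nonzero: "z \<in> cyclotomic_ints p" "z \<noteq> 0"
  obtains b where "\<And>k w. w \<in> cyclotomic_ints p \<Longrightarrow> z = lambda p ^ k * w \<Longrightarrow> k \<le> b"
proof -
  obtain N t where multiple: "N \<noteq> 0" "t \<in> cyclotomic_ints p" "of_int N = z * t"
    using cyclotomic_int_dvd_int[OF _ z_nonzero] prime by (metis prime_gt_0_nat)
  obtain s m where decomp: "N = int p ^ s * m" "\<not> int p dvd m"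
    using multiplicity_decompose'[of N "int p"] multiple(1) prime
    by (metis not_prime_unit prime_nat_int_transfer)
  have "k \<le> s * (p - 1)" if factorization: "w \<in> cyclotomic_ints p" "z = lambda p ^ k * w" for k w
  proof (rule ccontr)
    assume "\<not> k \<le> s * (p - 1)"
    then obtain j where k_eq: "k = s * (p - 1) + 1 + j"
      using le_Suc_ex[of "s * (p - 1) + 1" k] by auto
    have "of_nat p ^ s * of_int m = (of_int N :: complex)"
      by (simp add: decomp(1))
    also have "\<dots> = lambda p ^ (s * (p - 1) + 1) * (lambda p ^ j * w * t)"
      unfolding multiple(3) factorization(2) k_eq power_add[of _ "s * (p - 1) + 1" j]
      by (simp only: mult.assoc)
    finally have "int p dvd m"
      by (rule lambda_power_dvd_imp_prime_dvd[OF prime, rotated])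
        (simp add: factorization(1) multiple(2))
    thus False
      using decomp(2) by simp
  qed
  thus ?thesis
    by (rule that)
qed

lemma lambda_factorization:
  assumes prime: "prime p" and z_nonzero: "z \<in> cyclotomic_ints p" "z \<noteq> 0"
  obtains k u where "u \<in> lambda_units p" "z = lambda p ^ k * u"
proof -
  define P where "P k \<longleftrightarrow> (\<exists>w\<in>cyclotomic_ints p. z = lambda p ^ k * w)" for k
  obtain b where bounded: "\<And>k. P k \<Longrightarrow> k \<le> b"
    using lambda_power_exponent_bounded[OF prime z_nonzero] unfolding P_def by metis
  have "P 0"
    using z_nonzero by (auto simp: P_def)
  define k where "k = (GREATEST k. P k)"
  have "P k"
    unfolding k_def using \<open>P 0\<close> bounded by (rule GreatestI_nat)
  then obtain u where factorization: "u \<in> cyclotomic_ints p" "z = lambda p ^ k * u"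
    unfolding P_def by blast
  have "u \<notin> lambda_ideal p"
  proof
    assume "u \<in> lambda_ideal p"
    then obtain w where "w \<in> cyclotomic_ints p" "u = lambda p * w"
      by blast
    hence "P (Suc k)"
      unfolding P_def by (intro bexI[of _ w])
        (simp_all only: factorization(2) power_Suc2 mult.assoc)
    hence "Suc k \<le> k"
      unfolding k_def using bounded by (rule Greatest_le_nat)
    thus False
      by simp
  qed
  thus ?thesis
    using that factorization by blast
qed

lemma lambda_exponent_unique:
  assumes prime: "prime p"
    and units: "u \<in> lambda_units p" "v \<in> lambda_units p" "u' \<in> lambda_units p" "v' \<in> lambda_units p"
    and eq: "lambda p powi i * u / v = lambda p powi j * u' / v'"
  shows "i = j"
proof -
  define l where "l = lambda p"
  have "l \<noteq> 0"
    using lambda_nonzero[OF prime] by (simp add: l_def)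
  have exponent_le: "i \<le> j"
    if units: "u \<in> lambda_units p" "v \<in> lambda_units p" "u' \<in> lambda_units p" "v' \<in> lambda_units p"
      and eq: "l powi i * u / v = l powi j * u' / v'"
    for i j :: int and u v u' v'
  proof (rule ccontr)
    assume "\<not> i \<le> j"
    then obtain n where i_eq: "i = j + 1 + int n"
      using zle_iff_zadd[of "j + 1" i] by auto
    have "l powi i = l powi j * (l * l ^ n)"
      unfolding i_eq using \<open>l \<noteq> 0\<close> by (simp add: power_int_add)
    hence "u' * v = l * (l ^ n * u * v')"
      using eq units[THEN lambda_units_nonzero] \<open>l \<noteq> 0\<close> by (simp add: field_simps)
    moreover have "l ^ n * u * v' \<in> cyclotomic_ints p"
      using units by (simp add: l_def)
    ultimately have "u' * v \<in> lambda_ideal p"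
      unfolding l_def by blast
    thus False
      using lambda_units_mult[OF prime units(3,2)] by simp
  qed
  show ?thesis
    using exponent_le[OF units, of i j] exponent_le[OF units(3,4,1,2), of j i] eq
    by (simp add: l_def)
qed

lemma val_p_lambda_power_mult_unit:
  assumes prime: "prime p" and unit: "u \<in> lambda_units p"
  shows "val_p p (lambda p ^ k * u) = ereal (real k / (real p - 1))"
proof -
  let ?P = "\<lambda>j. \<exists>u' v. {u', v} \<subseteq> lambda_units p \<and> lambda p ^ k * u = lambda p powi j * u' / v"
  have "(THE j. ?P j) = int k"
  proof (rule the_equality)
    show "?P (int k)"
      by (rule exI[of _ u], rule exI[of _ 1]) (use unit one_in_lambda_units[OF prime] in simp)
  next
    fix j assume "?P j"
    then obtain u' v where other: "u' \<in> lambda_units p" "v \<in> lambda_units p"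
        "lambda p powi j * u' / v = lambda p powi int k * u / 1"
      by auto
    show "j = int k"
      using other unit one_in_lambda_units[OF prime] by (intro lambda_exponent_unique[OF prime])
  qed
  moreover have "lambda p ^ k * u \<noteq> 0"
    using lambda_nonzero[OF prime] lambda_units_nonzero[OF unit] by simp
  ultimately show ?thesis
    by (simp add: val_p_def)
qed

lemma val_p_lambda_unit:
  assumes "prime p" "u \<in> lambda_units p"
  shows "val_p p u = 0"
  using val_p_lambda_power_mult_unit[OF assms, of 0] by simp

lemma val_p_1:
  assumes "prime p"
  shows "val_p p 1 = 0"
  by (intro val_p_lambda_unit one_in_lambda_units assms)

lemma val_p_0 [simp]: "val_p p 0 = \<infinity>"
  by (simp add: val_p_def)

lemma val_p_mult:
  assumes prime: "prime p"
    and x_cyclotomic: "x \<in> cyclotomic_ints p" and y_cyclotomic: "y \<in> cyclotomic_ints p"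
  shows "val_p p (x * y) = val_p p x + val_p p y"
proof (cases "x = 0 \<or> y = 0")
  case True
  thus ?thesis
    by auto
next
  case False
  obtain i u where x_factor: "u \<in> lambda_units p" "x = lambda p ^ i * u"
    using lambda_factorization[OF prime x_cyclotomic] False by blast
  obtain j v where y_factor: "v \<in> lambda_units p" "y = lambda p ^ j * v"
    using lambda_factorization[OF prime y_cyclotomic] False by blast
  have "val_p p (x * y) = val_p p (lambda p ^ (i + j) * (u * v))"
    by (simp add: x_factor(2) y_factor(2) power_add mult_ac)
  also have "\<dots> = ereal (real (i + j) / (real p - 1))"
    using x_factor(1) y_factor(1) by (intro val_p_lambda_power_mult_unit lambda_units_mult prime)
  also have "\<dots> = val_p p x + val_p p y"
    using x_factor y_factor
    by (simp add: val_p_lambda_power_mult_unit[OF prime] add_divide_distrib)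
  finally show ?thesis .
qed

lemma val_p_nonneg:
  assumes prime: "prime p" and x_cyclotomic: "x \<in> cyclotomic_ints p"
  shows "0 \<le> val_p p x"
proof (cases "x = 0")
  case False
  then obtain k u where "u \<in> lambda_units p" "x = lambda p ^ k * u"
    using lambda_factorization[OF prime x_cyclotomic] by blast
  thus ?thesis
    using prime_gt_1_nat[OF prime] by (simp add: val_p_lambda_power_mult_unit[OF prime])
qed simp

lemma val_p_add:
  assumes prime: "prime p"
    and x_cyclotomic: "x \<in> cyclotomic_ints p" and y_cyclotomic: "y \<in> cyclotomic_ints p"
  shows "min (val_p p x) (val_p p y) \<le> val_p p (x + y)"
proof (cases "x = 0 \<or> y = 0")
  case True
  thus ?thesis
    by auto
next
  case False
  have val_le: "val_p p (lambda p ^ i * u) \<le> val_p p (lambda p ^ i * u + lambda p ^ j * v)"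
    if "i \<le> j" "u \<in> lambda_units p" "v \<in> lambda_units p" for i j u v
  proof -
    let ?w = "u + lambda p ^ (j - i) * v"
    have w_cyclotomic: "?w \<in> cyclotomic_ints p"
      using that by simp
    have "val_p p (lambda p ^ i * u) = val_p p (lambda p ^ i)"
      using that val_p_lambda_unit[OF prime that(2)] by (simp add: val_p_mult[OF prime])
    also have "\<dots> \<le> val_p p (lambda p ^ i) + val_p p ?w"
      using val_p_nonneg[OF prime w_cyclotomic] by (simp add: add_increasing2)
    also have "\<dots> = val_p p (lambda p ^ i * ?w)"
      using w_cyclotomic by (simp add: val_p_mult[OF prime])
    also have "lambda p ^ i * ?w = lambda p ^ i * u + lambda p ^ j * v"
      using that(1) by (simp add: distrib_left flip: mult.assoc power_add)
    finally show ?thesis .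
  qed
  obtain i u where x_factor: "u \<in> lambda_units p" "x = lambda p ^ i * u"
    using lambda_factorization[OF prime x_cyclotomic] False by blast
  obtain j v where y_factor: "v \<in> lambda_units p" "y = lambda p ^ j * v"
    using lambda_factorization[OF prime y_cyclotomic] False by blast
  show ?thesis
    using val_le[OF _ x_factor(1) y_factor(1), of i j] val_le[OF _ y_factor(1) x_factor(1), of j i]
    unfolding x_factor(2) y_factor(2)
    by (cases "i \<le> j") (auto simp: min_le_iff_disj add.commute)
qed

lemma less_val_p_sum:
  assumes prime: "prime p" and "\<And>i. i \<in> A \<Longrightarrow> f i \<in> cyclotomic_ints p"
    and "\<And>i. i \<in> A \<Longrightarrow> ereal c < val_p p (f i)"
  shows "ereal c < val_p p (\<Sum>i\<in>A. f i)"
  using assms(2,3)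
proof (induction A rule: infinite_finite_induct)
  case (insert i A)
  have "ereal c < min (val_p p (f i)) (val_p p (\<Sum>i\<in>A. f i))"
    using insert by simp
  also have "\<dots> \<le> val_p p (\<Sum>i\<in>insert i A. f i)"
    using insert val_p_add[OF prime] by simp
  finally show ?case .
qed simp_all

lemma val_p_prod:
  assumes prime: "prime p" and "\<And>i. i \<in> A \<Longrightarrow> f i \<in> cyclotomic_ints p"
  shows "val_p p (\<Prod>i\<in>A. f i) = (\<Sum>i\<in>A. val_p p (f i))"
  using assms(2)
proof (induction A rule: infinite_finite_induct)
  case (insert i A)
  thus ?case
    by (simp add: val_p_mult[OF prime])
qed (simp_all add: val_p_1[OF prime])

lemma val_p_of_int_coprime:
  assumes "prime p" "\<not> int p dvd m"
  shows "val_p p (of_int m) = 0"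
  using assms by (intro val_p_lambda_unit) (simp_all add: of_int_in_lambda_ideal_iff)

lemma val_p_prime:
  assumes prime: "prime p"
  shows "val_p p (of_nat p) = 1"
proof -
  obtain f where lambda_power: "poly f 1 = -1" "lambda p ^ (p - 1) = of_nat p * poly_zeta p f"
    using lambda_power_eq_prime_mult[OF prime] .
  have "poly_zeta p f \<in> lambda_units p"
    using poly_zeta_in_lambda_ideal_iff[OF prime, of f] lambda_power(1) prime_gt_1_nat[OF prime]
    by simp
  hence "val_p p (of_nat p) = val_p p (of_nat p * poly_zeta p f)"
    by (simp add: val_p_mult[OF prime] val_p_lambda_unit[OF prime])
  also have "\<dots> = val_p p (lambda p ^ (p - 1) * 1)"
    by (simp only: lambda_power(2) mult_1_right)
  also have "\<dots> = 1"
    using prime_gt_1_nat[OF prime]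
    by (subst val_p_lambda_power_mult_unit[OF prime one_in_lambda_units[OF prime]])
      (simp add: of_nat_diff)
  finally show ?thesis .
qed

lemma val_p_prime_power:
  assumes "prime p"
  shows "val_p p (of_nat p ^ n) = ereal (real n)"
  by (induction n)
    (simp_all add: val_p_mult[OF assms] val_p_prime[OF assms] val_p_1[OF assms] one_ereal_def)

section \<open>The canonical additive character\<close>

lemma bij_betw_of_nat_prime_field:
  "bij_betw of_nat {..<CHAR('a::finite_field)} (range (of_int :: int \<Rightarrow> 'a))"
proof (rule bij_betw_imageI)
  show "inj_on (of_nat :: nat \<Rightarrow> 'a) {..<CHAR('a)}"
    by (rule inj_onI) (simp add: of_nat_eq_iff_cong_CHAR cong_def)
  have "of_int i \<in> (of_nat :: nat \<Rightarrow> 'a) ` {..<CHAR('a)}" for i :: int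
  proof
    have "of_int i = (of_int (int CHAR('a) * (i div int CHAR('a)) + i mod int CHAR('a)) :: 'a)"
      by simp
    also have "\<dots> = of_int (i mod int CHAR('a))"
      by (simp only: of_int_add of_int_mult of_int_of_nat_eq of_nat_CHAR) simp
    also have "i mod int CHAR('a) = int (nat (i mod int CHAR('a)))"
      by simp
    finally show "of_int i = (of_nat (nat (i mod int CHAR('a))) :: 'a)"
      by simp
    show "nat (i mod int CHAR('a)) \<in> {..<CHAR('a)}"
      by (simp add: nat_less_iff)
  qed
  thus "(of_nat :: nat \<Rightarrow> 'a) ` {..<CHAR('a)} = range of_int"
    by (auto intro: range_eqI[of _ _ "int _"])
qed

lemma card_prime_field: "card (range (of_int :: int \<Rightarrow> 'a::finite_field)) = CHAR('a)"
  using bij_betw_same_card[OF bij_betw_of_nat_prime_field[where ?'a = 'a]] by simp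

lemma subfield_prime_field:
  "subfield (range of_int) (ring_of_type_algebra :: 'a::finite_field ring)"
proof -
  let ?R = "ring_of_type_algebra :: 'a ring"
  interpret R: field ?R by rule
  have add: "x \<oplus>\<^bsub>?R\<^esub> y = x + y" and mult: "x \<otimes>\<^bsub>?R\<^esub> y = x * y"
    and one: "\<one>\<^bsub>?R\<^esub> = 1" and zero: "\<zero>\<^bsub>?R\<^esub> = 0" and carrier: "carrier ?R = UNIV" for x y :: 'a
    by (simp_all add: ring_of_type_algebra_def)
  have minus: "\<ominus>\<^bsub>?R\<^esub> x = - x" for x :: 'a
    by (rule R.minus_equality) (simp_all add: add zero carrier)
  have "inv\<^bsub>?R\<^esub> x \<in> range of_int" if "x \<in> range of_int - {0}" for x :: 'a
  proof -
    have "x ^ (CARD('a) - 2) * x = x ^ (CARD('a) - 1)"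
      using power_minus_mult[of "CARD('a) - 1" x] one_less_CARD_finite_field[where ?'a = 'a]
      by (simp add: numeral_2_eq_2)
    also have "\<dots> = 1"
      using that by (intro finite_field_power_card_minus_1) simp
    finally have "x ^ (CARD('a) - 2) * x = 1" .
    hence "inv\<^bsub>?R\<^esub> x = x ^ (CARD('a) - 2)"
      by (intro R.comm_inv_char) (simp_all add: mult one carrier mult.commute)
    thus ?thesis
      using that by (auto simp flip: of_int_power)
  qed
  moreover have "subring (range of_int) ?R"
    by (rule R.subringI)
       (auto simp: add mult one minus carrier simp flip: of_int_add of_int_mult of_int_minus
          intro: range_eqI[of _ _ 1])
  ultimately show ?thesis
    by (intro R.subfieldI') (simp_all add: zero)
qed

lemma (in ring) card_eq_card_subfield_power:
  assumes subfield: "subfield K R" and "finite K" "dimension n K E"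
  shows "card E = card K ^ n"
proof -
  let ?coeffs = "{Ks. set Ks \<subseteq> K \<and> length Ks = n}"
  obtain Vs where base: "set Vs \<subseteq> carrier R" "independent K Vs" "length Vs = n" "Span K Vs = E"
    using exists_base[OF subfield assms(3)] by metis
  have combine: "combine Ks Vs \<in> E" if "Ks \<in> ?coeffs" for Ks
    using that Span_eq_combine_set_length_version[OF subfield base(1)] base(3,4) by auto
  have unique: "\<exists>!Ks. Ks \<in> ?coeffs \<and> a = combine Ks Vs" if "a \<in> E" for a
    using unique_decomposition[OF subfield base(2), of a] that base(3,4) by simp
  have "bij_betw (\<lambda>Ks. combine Ks Vs) ?coeffs E"
  proof (rule bij_betwI')
    show "combine Ks Vs = combine Ls Vs \<longleftrightarrow> Ks = Ls" if "Ks \<in> ?coeffs" "Ls \<in> ?coeffs" for Ks Ls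
      using unique[OF combine[OF that(1)]] that by metis
    show "\<exists>Ks\<in>?coeffs. a = combine Ks Vs" if "a \<in> E" for a
      using unique[OF that] by blast
  qed (rule combine)
  from bij_betw_same_card[OF this] show ?thesis
    using assms(2) by (simp add: card_lists_length_eq)
qed

lemma card_eq_CHAR_power: "CARD('a::finite_field) = CHAR('a) ^ prime_degree TYPE('a)"
proof -
  let ?R = "ring_of_type_algebra :: 'a ring" and ?K = "range of_int :: 'a set"
  interpret R: field ?R by rule
  have carrier: "carrier ?R = UNIV"
    by (simp add: ring_of_type_algebra_def)
  note subfield = subfield_prime_field[where ?'a = 'a]
  obtain Us :: "'a list" where "set Us = UNIV"
    using finite_list[of "UNIV :: 'a set"] by auto
  hence "R.Span ?K Us = UNIV"
    using R.Span_base_incl[OF subfield, of Us] carrier by auto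
  hence "R.finite_dimension ?K UNIV"
    using R.Span_finite_dimension[OF subfield, of Us] carrier by simp
  hence "R.dimension (prime_degree TYPE('a)) ?K UNIV"
    using R.finite_dimensionE[OF subfield] by (simp add: prime_degree_def over_def)
  from R.card_eq_card_subfield_power[OF subfield _ this] show ?thesis
    by (simp add: card_prime_field)
qed

lemma prime_degree_pos: "prime_degree TYPE('a::finite_field) > 0"
proof (rule Nat.gr0I)
  assume "prime_degree TYPE('a) = 0"
  thus False
    using one_less_CARD_finite_field[where ?'a = 'a] by (simp add: card_eq_CHAR_power)
qed

lemma abs_trace_add: "abs_trace (x + y) = abs_trace x + abs_trace (y :: 'a::finite_field)"
  unfolding abs_trace_def sum.distrib[symmetric]
  by (intro sum.cong refl freshmans_dream') auto

lemma frobenius_fixed_imp_prime_field: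
  fixes x :: "'a::finite_field"
  assumes "x ^ CHAR('a) = x"
  shows "x \<in> range of_int"
proof -
  define f :: "'a poly" where "f = monom 1 CHAR('a) - monom 1 1"
  have CHAR_gt_1: "CHAR('a) > 1"
    using prime_gt_1_nat[of "CHAR('a)"] by simp
  hence "coeff f CHAR('a) = 1"
    by (simp add: f_def)
  hence "f \<noteq> 0"
    by (metis coeff_0 zero_neq_one)
  have "degree f \<le> CHAR('a)"
    unfolding f_def using CHAR_gt_1 by (intro degree_diff_le) (auto simp: degree_monom_eq)
  hence card_roots: "card {x. poly f x = 0} \<le> CHAR('a)"
    using card_poly_roots_bound[OF \<open>f \<noteq> 0\<close>] by linarith
  have "(of_nat k :: 'a) ^ CHAR('a) = of_nat k" for k
    by (induction k) (simp_all add: freshmans_dream zero_power)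
  hence "of_nat ` {..<CHAR('a)} \<subseteq> {x. poly f x = 0}"
    by (auto simp: f_def poly_monom)
  hence "range of_int \<subseteq> {x. poly f x = 0}"
    using bij_betw_imp_surj_on[OF bij_betw_of_nat_prime_field[where ?'a = 'a]] by simp
  hence "range of_int = {x. poly f x = 0}"
    using card_roots by (intro card_seteq) (simp_all add: card_prime_field)
  thus ?thesis
    using assms by (auto simp: f_def poly_monom)
qed

lemma abs_trace_in_prime_field: "abs_trace (x :: 'a::finite_field) \<in> range of_int"
proof (rule frobenius_fixed_imp_prime_field)
  let ?n = "prime_degree TYPE('a)"
  have "abs_trace x ^ CHAR('a) = (\<Sum>i<?n. (x ^ (CHAR('a) ^ i)) ^ CHAR('a))"
    unfolding abs_trace_def by (intro freshmans_dream_sum) auto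
  also have "\<dots> = (\<Sum>i<?n. x ^ (CHAR('a) ^ Suc i))"
    by (simp add: mult.commute flip: power_mult)
  also have "\<dots> = (\<Sum>i<Suc ?n. x ^ (CHAR('a) ^ i)) - x"
    by (subst sum.lessThan_Suc_shift) simp
  also have "\<dots> = abs_trace x"
    using finite_field_power_card_eq_same[of x]
    by (simp add: abs_trace_def card_eq_CHAR_power[where ?'a = 'a])
  finally show "abs_trace x ^ CHAR('a) = abs_trace x" .
qed

lemma abs_trace_nontrivial: "\<exists>x :: 'a::finite_field. abs_trace x \<noteq> 0"
proof (rule ccontr)
  assume trivial: "\<not> (\<exists>x :: 'a. abs_trace x \<noteq> 0)"
  let ?n = "prime_degree TYPE('a)" and ?p = "CHAR('a)"
  define f :: "'a poly" where "f = (\<Sum>i<?n. monom 1 (?p ^ i))"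
  have p_gt_1: "?p > 1"
    using prime_gt_1_nat[of ?p] by simp
  have "coeff f 1 = (\<Sum>i<?n. if i = 0 then 1 else 0)"
    unfolding f_def coeff_sum using p_gt_1 by (intro sum.cong) auto
  hence "coeff f 1 = 1"
    using prime_degree_pos[where ?'a = 'a] by simp
  hence "f \<noteq> 0"
    by (metis coeff_0 zero_neq_one)
  have "{x. poly f x = 0} = UNIV"
    using trivial by (auto simp: f_def poly_sum poly_monom abs_trace_def)
  hence "CARD('a) \<le> degree f"
    using card_poly_roots_bound[OF \<open>f \<noteq> 0\<close>] by simp
  also have "degree f \<le> ?p ^ (?n - 1)"
    unfolding f_def using p_gt_1
    by (intro degree_sum_le) (auto simp: degree_monom_eq intro!: power_increasing)
  also have "\<dots> < ?p ^ ?n"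
    using p_gt_1 prime_degree_pos[where ?'a = 'a] by (intro power_strict_increasing) auto
  also have "\<dots> = CARD('a)"
    by (simp add: card_eq_CHAR_power)
  finally show False
    by simp
qed

lemma canonical_char_eq_zeta_power:
  fixes x :: "'a::finite_field"
  assumes "of_nat k = abs_trace x"
  shows "canonical_char x = zeta CHAR('a) ^ k"
proof -
  define j where "j = (LEAST k. of_nat k = abs_trace x)"
  have "of_nat j = abs_trace x"
    unfolding j_def using assms by (rule LeastI)
  hence "[j = k] (mod CHAR('a))"
    using assms by (simp flip: of_nat_eq_iff_cong_CHAR[where ?'a = 'a])
  hence "zeta CHAR('a) ^ j = zeta CHAR('a) ^ k"
    by (rule power_eq_if_cong[OF zeta_power_self, rotated]) simp
  moreover have "canonical_char x = zeta CHAR('a) ^ j"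
    by (simp add: canonical_char_def j_def zeta_def mult_ac flip: exp_of_nat_mult)
  ultimately show ?thesis
    by simp
qed

lemma abs_trace_eq_of_nat:
  obtains k where "of_nat k = abs_trace (x :: 'a::finite_field)"
  using abs_trace_in_prime_field[of x]
    bij_betw_imp_surj_on[OF bij_betw_of_nat_prime_field[where ?'a = 'a]] by (metis imageE)

lemma canonical_char_add:
  "canonical_char (x + y) = canonical_char x * canonical_char (y :: 'a::finite_field)"
proof -
  obtain j k where "of_nat j = abs_trace x" "of_nat k = abs_trace y"
    using abs_trace_eq_of_nat by metis
  moreover from this have "of_nat (j + k) = abs_trace (x + y)"
    by (simp add: abs_trace_add)
  ultimately show ?thesis
    by (simp only: canonical_char_eq_zeta_power power_add)
qed

lemma canonical_char_0 [simp]: "canonical_char (0 :: 'a::finite_field) = 1"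
  using canonical_char_eq_zeta_power[of 0 "0 :: 'a"] by (simp add: abs_trace_def zero_power)

lemma canonical_char_sum:
  "canonical_char (\<Sum>i\<in>A. f i) = (\<Prod>i\<in>A. canonical_char (f i :: 'a::finite_field))"
  by (induction A rule: infinite_finite_induct) (simp_all add: canonical_char_add)

lemma canonical_char_in_cyclotomic_ints:
  "canonical_char (x :: 'a::finite_field) \<in> cyclotomic_ints CHAR('a)"
  using abs_trace_eq_of_nat[of x] canonical_char_eq_zeta_power[of _ x]
  by (metis cyclotomic_ints_power cyclotomic_ints_zeta)

lemma canonical_char_nontrivial: "\<exists>x :: 'a::finite_field. canonical_char x \<noteq> 1"
proof -
  let ?p = "CHAR('a)"
  obtain x :: 'a where "abs_trace x \<noteq> 0"
    using abs_trace_nontrivial by blast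
  moreover obtain k where trace: "of_nat k = abs_trace x"
    using abs_trace_eq_of_nat by blast
  ultimately have "\<not> ?p dvd k"
    by (simp flip: of_nat_eq_0_iff_char_dvd)
  hence "coprime k ?p"
    using prime_imp_coprime[of ?p k] by (simp add: coprime_commute)
  then obtain e where "[k * e = 1] (mod ?p)"
    using cong_solve_coprime_nat by auto
  hence "(zeta ?p ^ k) ^ e = zeta ?p"
    using power_eq_if_cong[OF zeta_power_self, of ?p "k * e" 1] by (simp add: power_mult)
  hence "zeta ?p ^ k \<noteq> 1"
    using zeta_neq_1[of ?p] prime_gt_1_nat[of ?p] by auto
  thus ?thesis
    using canonical_char_eq_zeta_power[OF trace] by metis
qed

lemma sum_additive_char_eq_0:
  fixes \<psi> :: "'a::{finite, ab_group_add} \<Rightarrow> 'b::idom"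
  assumes additive: "\<And>x y. \<psi> (x + y) = \<psi> x * \<psi> y" and nontrivial: "\<psi> y \<noteq> 1"
  shows "(\<Sum>x\<in>UNIV. \<psi> x) = 0"
proof -
  have "(\<Sum>x\<in>UNIV. \<psi> x) = (\<Sum>x\<in>UNIV. \<psi> (x + y))"
    by (rule sum.reindex_bij_witness[of _ "\<lambda>x. x + y" "\<lambda>x. x - y"]) simp_all
  also have "\<dots> = (\<Sum>x\<in>UNIV. \<psi> x) * \<psi> y"
    by (simp add: additive sum_distrib_right)
  finally show ?thesis
    using nontrivial by simp
qed

lemma sum_canonical_char:
  fixes a :: "'a::finite_field"
  shows "(\<Sum>x\<in>UNIV. canonical_char (a * x)) = (if a = 0 then of_nat CARD('a) else 0)"
proof (cases "a = 0")
  case False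
  obtain y :: 'a where "canonical_char y \<noteq> 1"
    using canonical_char_nontrivial by blast
  hence "canonical_char (a * (y / a)) \<noteq> 1"
    using False by simp
  thus ?thesis
    using False sum_additive_char_eq_0[of "\<lambda>x. canonical_char (a * x)" "y / a"]
    by (simp add: distrib_left canonical_char_add)
qed simp

section \<open>Moments of the Weil sums\<close>

lemma sum_prod_sum_canonical_char:
  fixes r :: "'n::finite \<Rightarrow> 'a::finite_field" and f :: "'n \<Rightarrow> 'a \<Rightarrow> 'a"
  shows "(\<Sum>a\<in>UNIV. \<Prod>i\<in>UNIV. \<Sum>x\<in>UNIV. canonical_char (f i x - r i * a * x)) =
    of_nat CARD('a) * (\<Sum>v\<in>hyperplane r. canonical_char (\<Sum>i\<in>UNIV. f i (v i)))"
proof -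
  define S where "S v = (\<Sum>i\<in>UNIV. f i (v i))" for v :: "'n \<Rightarrow> 'a"
  have prod: "(\<Prod>i\<in>UNIV. \<Sum>x\<in>UNIV. canonical_char (f i x - r i * a * x)) =
      (\<Sum>v\<in>UNIV. canonical_char (S v) * canonical_char (- (\<Sum>i\<in>UNIV. r i * v i) * a))" for a
  proof -
    have "(\<Prod>i\<in>UNIV. \<Sum>x\<in>UNIV. canonical_char (f i x - r i * a * x)) =
        (\<Sum>v\<in>UNIV. \<Prod>i\<in>UNIV. canonical_char (f i (v i) - r i * a * v i))"
      by (subst prod_sum_PiE) simp_all
    also have "\<dots> = (\<Sum>v\<in>UNIV. canonical_char (\<Sum>i\<in>UNIV. f i (v i) - r i * a * v i))"
      by (simp only: canonical_char_sum)
    also have "\<dots> = (\<Sum>v\<in>UNIV. canonical_char (S v + - (\<Sum>i\<in>UNIV. r i * v i) * a))"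
      by (simp add: S_def sum_subtractf sum_distrib_left mult_ac)
    finally show ?thesis
      by (simp only: canonical_char_add)
  qed
  have "(\<Sum>a\<in>UNIV. \<Prod>i\<in>UNIV. \<Sum>x\<in>UNIV. canonical_char (f i x - r i * a * x)) =
      (\<Sum>v\<in>UNIV. canonical_char (S v) * (\<Sum>a\<in>UNIV. canonical_char (- (\<Sum>i\<in>UNIV. r i * v i) * a)))"
    unfolding prod sum_distrib_left by (rule sum.swap)
  also have "\<dots> = (\<Sum>v\<in>UNIV. if v \<in> hyperplane r then of_nat CARD('a) * canonical_char (S v) else 0)"
    unfolding sum_canonical_char by (intro sum.cong) (auto simp: hyperplane_def)
  also have "\<dots> = of_nat CARD('a) * (\<Sum>v\<in>hyperplane r. canonical_char (S v))"
    by (simp add: sum_distrib_left flip: sum.inter_filter)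
  finally show ?thesis
    by (simp only: S_def)
qed

lemma card_hyperplane:
  fixes r :: "'n::finite \<Rightarrow> 'a::finite_field"
  assumes "r \<noteq> (\<lambda>_. 0)"
  shows "card (hyperplane r) = CARD('a) ^ (CARD('n) - 1)"
proof -
  obtain j where nonzero: "r j \<noteq> 0"
    using assms by auto
  have "(\<Prod>i\<in>UNIV. \<Sum>x\<in>UNIV. canonical_char (0 - r i * a * x)) =
      (if a = 0 then of_nat CARD('a) ^ CARD('n) else 0)" for a
  proof (cases "a = 0")
    case False
    hence "(\<Sum>x\<in>UNIV. canonical_char (0 - r j * a * x)) = 0"
      using sum_canonical_char[of "- (r j * a)"] nonzero by simp
    thus ?thesis
      using False by (auto intro!: prod_zero)
  qed simp
  hence "of_nat CARD('a) ^ CARD('n) = (of_nat CARD('a) * of_nat (card (hyperplane r)) :: complex)"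
    using sum_prod_sum_canonical_char[of "\<lambda>_ _. 0" r] by simp
  hence "CARD('a) ^ CARD('n) = CARD('a) * card (hyperplane r)"
    by (simp only: of_nat_eq_iff flip: of_nat_power of_nat_mult)
  moreover have "CARD('a) ^ CARD('n) = CARD('a) * CARD('a) ^ (CARD('n) - 1)"
    by (simp add: power_eq_if)
  ultimately show ?thesis
    by simp
qed

lemma card_zeros_of_homogeneous:
  fixes L :: "('n::finite \<Rightarrow> 'a::finite_field) set" and S :: "('n \<Rightarrow> 'a) \<Rightarrow> 'a"
  assumes "surj (\<lambda>x::'a. x ^ d)" "d > 0"
    and cone: "\<And>c v. v \<in> L \<Longrightarrow> (\<lambda>i. c * v i) \<in> L"
    and homogeneous: "\<And>c v. S (\<lambda>i. c * v i) = c ^ d * S v"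
  shows "of_nat CARD('a) * of_nat (card {v \<in> L. S v = 0}) =
    of_nat (card L) + (of_nat CARD('a) - 1) * (\<Sum>v\<in>L. canonical_char (S v))"
proof -
  define T where "T m = (\<Sum>v\<in>L. canonical_char (S v * m))" for m
  have scale: "T m = T 1" if "m \<noteq> 0" for m
  proof -
    obtain c where m_eq: "m = c ^ d"
      using assms(1) by (metis surjD)
    hence "c \<noteq> 0"
      using that assms(2) by auto
    thus ?thesis
      unfolding T_def m_eq
      by (intro sum.reindex_bij_witness[of _ "\<lambda>v i. inverse c * v i" "\<lambda>v i. c * v i"])
        (simp_all add: cone homogeneous mult.commute[of _ "c ^ d"] flip: mult.assoc)
  qed
  have "of_nat CARD('a) * of_nat (card {v \<in> L. S v = 0}) =
      (\<Sum>v\<in>L. if S v = 0 then of_nat CARD('a) else (0 :: complex))"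
    by (simp add: mult.commute flip: sum.inter_filter)
  also have "\<dots> = (\<Sum>m\<in>UNIV. T m)"
    unfolding T_def by (subst sum.swap) (simp add: sum_canonical_char)
  also have "\<dots> = T 0 + (\<Sum>m\<in>UNIV - {0}. T m)"
    by (rule sum.remove) simp_all
  also have "(\<Sum>m\<in>UNIV - {0}. T m) = (\<Sum>m\<in>UNIV - {0 :: 'a}. T 1)"
    by (intro sum.cong refl scale) simp
  also have "T 0 + \<dots> = of_nat (card L) + (of_nat CARD('a) - 1) * T 1"
    by (simp add: T_def card_Diff_subset of_nat_diff)
  finally show ?thesis
    by (simp add: T_def)
qed

lemma weil_sum_moment:
  fixes r :: "'n::finite \<Rightarrow> 'a::finite_field"
  assumes r_nonzero: "r \<noteq> (\<lambda>_. 0)" and surj: "surj (\<lambda>x::'a. x ^ d)" and d_pos: "d > 0"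
  shows "(of_nat CARD('a) - 1) * (\<Sum>a\<in>UNIV. \<Prod>i\<in>UNIV. weil_sum d (r i * a)) =
    of_nat CARD('a) * (of_nat CARD('a) * of_nat (card (hyperplane r \<inter> fermat_cone d)) -
      of_nat CARD('a) ^ (CARD('n) - 1))"
proof -
  define T where "T = (\<Sum>v\<in>hyperplane r. canonical_char (\<Sum>i\<in>UNIV. v i ^ d))"
  have "hyperplane r \<inter> fermat_cone d = {v \<in> hyperplane r. (\<Sum>i\<in>UNIV. v i ^ d) = 0}"
    by (auto simp: fermat_cone_def)
  moreover have "of_nat CARD('a) * of_nat (card {v \<in> hyperplane r. (\<Sum>i\<in>UNIV. v i ^ d) = 0}) =
      of_nat (card (hyperplane r)) + (of_nat CARD('a) - 1) * T"
    unfolding T_def using surj d_pos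
  proof (rule card_zeros_of_homogeneous)
    show "(\<lambda>i. c * v i) \<in> hyperplane r" if "v \<in> hyperplane r" for c v
      using that by (simp add: hyperplane_def mult.left_commute[of _ c] flip: sum_distrib_left)
    show "(\<Sum>i\<in>UNIV. (c * v i) ^ d) = c ^ d * (\<Sum>i\<in>UNIV. v i ^ d)" for c :: 'a and v :: "'n \<Rightarrow> 'a"
      by (simp add: power_mult_distrib sum_distrib_left)
  qed
  ultimately have "(of_nat CARD('a) - 1) * T =
      of_nat CARD('a) * of_nat (card (hyperplane r \<inter> fermat_cone d)) -
      of_nat CARD('a) ^ (CARD('n) - 1)"
    by (simp add: card_hyperplane[OF r_nonzero])
  moreover have "(\<Sum>a\<in>UNIV. \<Prod>i\<in>UNIV. weil_sum d (r i * a)) = of_nat CARD('a) * T"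
    unfolding weil_sum_def T_def by (rule sum_prod_sum_canonical_char)
  ultimately show ?thesis
    by (simp add: mult.left_commute)
qed

lemma weil_sum_in_cyclotomic_ints [simp]:
  "weil_sum d (a :: 'a::finite_field) \<in> cyclotomic_ints CHAR('a)"
  unfolding weil_sum_def by (intro cyclotomic_ints_sum canonical_char_in_cyclotomic_ints)

lemma ereal_card_mult_less_sum:
  fixes f :: "'b \<Rightarrow> ereal"
  assumes "finite A" "A \<noteq> {}" "\<And>i. i \<in> A \<Longrightarrow> ereal c < f i"
  shows "ereal (real (card A) * c) < (\<Sum>i\<in>A. f i)"
  using assms
proof (induction A rule: finite_ne_induct)
  case (insert i A)
  have "ereal c + ereal (real (card A) * c) < f i + (\<Sum>i\<in>A. f i)"
    using insert by (intro ereal_add_strict_mono2) auto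
  thus ?case
    using insert by (simp add: algebra_simps)
qed simp

lemma val_p_card_power_mult_one_minus:
  assumes "m > 0"
  shows "val_p CHAR('a) (of_nat CARD('a::finite_field) ^ k * (1 - of_nat CARD('a) ^ m)) =
    ereal (real (k * prime_degree TYPE('a)))"
proof -
  let ?p = "CHAR('a)" and ?n = "prime_degree TYPE('a)"
  have prime: "prime ?p"
    by simp
  have "int ?p dvd int CARD('a)"
    using prime_degree_pos[where ?'a = 'a] by (simp add: card_eq_CHAR_power[where ?'a = 'a])
  hence "int ?p dvd int CARD('a) ^ m"
    by (rule dvd_trans) (use assms in \<open>simp add: dvd_power\<close>)
  hence "\<not> int ?p dvd 1 - int CARD('a) ^ m"
    using prime_gt_1_nat[OF prime] by (subst dvd_diff_left_iff) simp_all
  hence "val_p ?p (of_int (1 - int CARD('a) ^ m)) = 0"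
    by (rule val_p_of_int_coprime[OF prime])
  moreover have "of_nat CARD('a) ^ k = (of_nat ?p ^ (k * ?n) :: complex)"
    by (simp add: card_eq_CHAR_power[where ?'a = 'a] mult.commute flip: power_mult)
  ultimately show ?thesis
    by (simp add: val_p_mult[OF prime] val_p_prime_power[OF prime])
qed

lemma less_val_p_weil_sum_moment:
  fixes r :: "'n::finite \<Rightarrow> 'a::finite_field"
  assumes "\<And>a :: 'a. ereal c < val_p CHAR('a) (weil_sum d a)"
  shows "ereal (real CARD('n) * c) <
    val_p CHAR('a) (\<Sum>a\<in>UNIV. \<Prod>i\<in>UNIV. weil_sum d (r i * a))"
proof (rule less_val_p_sum)
  show prime: "prime CHAR('a)"
    by simp
  show "ereal (real CARD('n) * c) < val_p CHAR('a) (\<Prod>i\<in>UNIV. weil_sum d (r i * a))" for a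
    unfolding val_p_prod[OF prime weil_sum_in_cyclotomic_ints]
    by (intro ereal_card_mult_less_sum assms) simp_all
qed simp

lemma weil_val_imp_blocking_fermat_cone:
  assumes dim: "CARD('n::finite) \<ge> 3"
    and surj: "surj (\<lambda>x::'a::finite_field. x ^ d)" and d_pos: "d > 0"
    and val: "\<And>a :: 'a. ereal (2 / real CARD('n) * real (prime_degree TYPE('a))) <
      val_p CHAR('a) (weil_sum d a)"
  shows "blocking_cone (fermat_cone d :: ('n \<Rightarrow> 'a) set)"
  unfolding blocking_cone_def
proof (intro allI impI, rule ccontr)
  let ?p = "CHAR('a)" and ?n = "prime_degree TYPE('a)" and ?q = "of_nat CARD('a) :: complex"
  fix r :: "'n \<Rightarrow> 'a"
  assume r_nonzero: "r \<noteq> (\<lambda>_. 0)" and "\<not> (\<exists>v \<in> hyperplane r \<inter> fermat_cone d. v \<noteq> (\<lambda>_. 0))"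
  moreover have "(\<lambda>_. 0) \<in> hyperplane r \<inter> fermat_cone d"
    using d_pos by (simp add: hyperplane_def fermat_cone_def)
  ultimately have only_zero: "hyperplane r \<inter> fermat_cone d = {\<lambda>_. 0}"
    by blast
  define M where "M = (\<Sum>a\<in>UNIV. \<Prod>i\<in>UNIV. weil_sum d (r i * a))"
  have prime: "prime ?p"
    by simp
  have M_cyclotomic: "M \<in> cyclotomic_ints ?p"
    by (simp add: M_def)
  obtain m where m_eq: "CARD('n) - 1 = Suc m" and m_pos: "m > 0"
    using dim by (intro that[of "CARD('n) - 2"]) simp_all
  have moment: "(?q - 1) * M = ?q ^ 2 * (1 - ?q ^ m)"
    using weil_sum_moment[OF r_nonzero surj d_pos] m_eq only_zero
    by (simp add: M_def algebra_simps power2_eq_square)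
  have "ereal (real (2 * ?n)) < val_p ?p M"
    using less_val_p_weil_sum_moment[OF val, of r] by (simp add: M_def)
  also have "\<dots> \<le> val_p ?p (?q - 1) + val_p ?p M"
    using val_p_nonneg[OF prime, of "?q - 1"] by (simp add: add_increasing)
  also have "\<dots> = val_p ?p (?q ^ 2 * (1 - ?q ^ m))"
    by (simp add: M_cyclotomic val_p_mult[OF prime] flip: moment)
  also have "\<dots> = ereal (real (2 * ?n))"
    by (rule val_p_card_power_mult_one_minus[OF m_pos])
  finally show False
    by simp
qed

theorem theorem3p1:
  fixes d :: nat
  assumes "d > 0"
    and "gcd d (CARD('a::finite_field) - 1) = 1"
    and "\<not> degenerate TYPE('a) d"
  shows "weil_min_val TYPE('a) d \<le> ereal (2 / 3 * real (prime_degree TYPE('a)))"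
proof (rule ccontr)
  assume "\<not> ?thesis"
  hence val: "ereal (2 / 3 * real (prime_degree TYPE('a))) < val_p CHAR('a) (weil_sum d a)"
    for a :: 'a
    by (auto simp: weil_min_val_def not_le)
  have bij: "bij (\<lambda>x::'a. x ^ d)"
    using assms by (intro bij_power_coprime) (simp_all add: coprime_iff_gcd_eq_1)
  have "blocking_cone (fermat_cone d :: (3 \<Rightarrow> 'a) set)"
    using val by (intro weil_val_imp_blocking_fermat_cone bij_is_surj[OF bij] assms(1)) simp_all
  hence "(1 + x) ^ d = 1 + x ^ d" for x :: 'a
    using blocking_fermat_cone_imp_power_one_minus[OF bij assms(1), of "- x"]
    by (simp add: power_minus_of_inj[OF bij_is_inj[OF bij]] algebra_simps)
  thus False
    using additive_power_imp_degenerate[OF assms(1)] assms(3) by blast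
qed

end
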